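(* Let $(X,d)$ be a compact metric space and let $(X,\mathcal{A},\mu,T)$ be a probability measure-preserving dynamical system. Suppose that $T$ is exponentially mixing with respect to $\mu$. Let $\psi:\mathbb{N}\to\mathbb{R}_{\ge 0}$ be a function, let $x_0\in X$, and for $n\in\mathbb{N}$ put $B_n:=B(x_0,\psi(n))$. For $x\in X$ and $N\in\mathbb{N}$ let $$W(x,N;T,\psi):=\#\{1\le n\le N: T^n x\in B_n\}=\sum_{n=1}^N \mathbf{1}_{B_n}(T^n x),\qquad \Phi(N):=\sum_{n=1}^N\mu(B_n).$$ Then, for any given $\varepsilon>0$, for $\mu$-almost all $x\in X$ we have $$W(x,N;T,\psi)=\Phi(N)+O\Big(\Phi(N)^{1/2}\,\big(\log(\Phi(N)+2)\big)^{3/2+\varepsilon}\Big)\qquad (N\in\mathbb{N}),$$ where the implied constant may depend on $x$ and $\varepsilon$ (and on the system, $\psi$ and $x_0$) but not on $N$.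
   Context: $(X,\mathcal{A},\mu,T)$ being a probability measure-preserving dynamical system means that $\mu$ is a probability measure on the $\sigma$-algebra $\mathcal{A}$ (which contains the Borel sets, so in particular all balls, of the compact metric space $(X,d)$), and $T:X\to X$ is measurable with $\mu(T^{-1}F)=\mu(F)$ for all $F\in\mathcal{A}$. $B(x,r)$ denotes the ball with centre $x\in X$ and radius $r\ge 0$ (open or closed, with the same convention used throughout). $\mathbf{1}_E$ is the characteristic function of a set $E$, and $\mathbb{N}=\{1,2,\dots\}$. $T$ is exponentially mixing with respect to $\mu$ if there exist constants $C>0$ and $\gamma\in(0,1)$ such that $$\big|\mu(B\cap T^{-n}F)-\mu(F)\mu(B)\big|\le C\,\gamma^n\,\mu(F)\qquad\text{for all } n\in\mathbb{N},$$ for all balls $B$ in $X$ and all $\mu$-measurable sets $F$ in $X$. *)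

theory Defs
  imports "HOL-Probability.Probability"
begin

text \<open>
  Balls may be open or closed, as long as the same kind is used throughout.  A convention is a
  function \<open>B\<close> (centre, radius) that is one of the two ball functions of the metric space.
\<close>

definition ball_convention :: "'a set \<Rightarrow> ('a \<Rightarrow> 'a \<Rightarrow> real) \<Rightarrow> ('a \<Rightarrow> real \<Rightarrow> 'a set) \<Rightarrow> bool" where
  "ball_convention X d B \<longleftrightarrow>
     B = Metric_space.mball X d \<or> B = Metric_space.mcball X d"

definition prob_mpds :: "'a set \<Rightarrow> ('a \<Rightarrow> 'a \<Rightarrow> real) \<Rightarrow> 'a measure \<Rightarrow> ('a \<Rightarrow> 'a) \<Rightarrow> bool" where
  "prob_mpds X d M T \<longleftrightarrow>
     prob_space M \<and> space M = X \<and>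
     sigma_sets X {U. openin (Metric_space.mtopology X d) U} \<subseteq> sets M \<and>
     T \<in> measurable M M \<and>
     (\<forall>F\<in>sets M. measure M (T -` F \<inter> space M) = measure M F)"

definition exponentially_mixing ::
    "('a \<Rightarrow> real \<Rightarrow> 'a set) \<Rightarrow> 'a measure \<Rightarrow> ('a \<Rightarrow> 'a) \<Rightarrow> bool" where
  "exponentially_mixing B M T \<longleftrightarrow>
     (\<exists>C \<gamma>. C > 0 \<and> 0 < \<gamma> \<and> \<gamma> < 1 \<and>
        (\<forall>n\<ge>1. \<forall>x\<in>space M. \<forall>r\<ge>0. \<forall>F\<in>sets M.
           \<bar>measure M (B x r \<inter> ((T ^^ n) -` F \<inter> space M)) - measure M F * measure M (B x r)\<bar>
             \<le> C * \<gamma> ^ n * measure M F))"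

definition hit_count ::
    "('a \<Rightarrow> real \<Rightarrow> 'a set) \<Rightarrow> ('a \<Rightarrow> 'a) \<Rightarrow> (nat \<Rightarrow> real) \<Rightarrow> 'a \<Rightarrow> 'a \<Rightarrow> nat \<Rightarrow> nat" where
  "hit_count B T \<psi> x0 x N = card {n \<in> {1..N}. (T ^^ n) x \<in> B x0 (\<psi> n)}"

lemma hit_count_eq_sum:
  "real (hit_count B T \<psi> x0 x N) = (\<Sum>n=1..N. indicator (B x0 (\<psi> n)) ((T ^^ n) x))"
  by (simp add: hit_count_def indicator_def sum.If_cases Int_def)

definition measure_sum ::
    "('a \<Rightarrow> real \<Rightarrow> 'a set) \<Rightarrow> 'a measure \<Rightarrow> (nat \<Rightarrow> real) \<Rightarrow> 'a \<Rightarrow> nat \<Rightarrow> real" where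
  "measure_sum B M \<psi> x0 N = (\<Sum>n=1..N. measure M (B x0 (\<psi> n)))"

end

theory Submission
  imports Defs
begin

text \<open>
  Write \<open>E\<^sub>n\<close> for the event \<open>T\<^sup>n x \<in> B\<^sub>n\<close>, so that the claim compares the number of events
  \<open>E\<^sub>1, \<dots>, E\<^sub>N\<close> that occur with the expected number \<open>\<Phi>(N)\<close>.  By invariance, for \<open>m < n\<close>
  the probability of \<open>E\<^sub>m \<inter> E\<^sub>n\<close> is the measure of \<open>B\<^sub>m \<inter> T\<^sup>-\<^sup>(\<^sup>n\<^sup>-\<^sup>m\<^sup>) B\<^sub>n\<close>, and mixing bounds
  the covariance of the two indicators by \<open>C \<gamma>\<^sup>n\<^sup>-\<^sup>m \<mu>(B\<^sub>n)\<close>.  The factor \<open>\<mu>(B\<^sub>n)\<close> of the later event is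
  decisive: summing the geometric series over \<open>m\<close> leaves a constant times \<open>\<mu>(B\<^sub>n)\<close>, so the centred
  count over a block of indices has second moment at most a constant times the \<open>\<Phi>\<close>-mass of the block
  (\<open>second_moment_le\<close>).  The rest of the argument is about events
  in a probability space.

  Such a bound gives an almost sure statement by a dyadic argument
  (\<open>gal_koksma_strong_law\<close>).  Each of \<open>1, \<dots>, 2\<^sup>r - 1\<close> is the end point of a disjoint union of at most
  \<open>r\<close> dyadic blocks starting at \<open>0\<close>, at most one of each length, so by the Cauchy-Schwarz inequality the square of
  every partial sum before \<open>2\<^sup>r\<close> is at most \<open>r\<close> times the single variable \<open>Y\<^sub>r\<close>, the sum of the
  squares over all dyadic blocks (\<open>dyadic_chaining\<close>).  The expectation of \<open>Y\<^sub>r\<close> is \<open>O(r 2\<^sup>r)\<close>; dividing by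
  \<open>2\<^sup>r r\<^sup>2\<^sup>+\<^sup>2\<^sup>\<epsilon>\<close> makes these expectations summable, so almost surely \<open>Y\<^sub>r = O(2\<^sup>r r\<^sup>2\<^sup>+\<^sup>2\<^sup>\<epsilon>)\<close>.  One factor
  \<open>r\<close> comes from Cauchy-Schwarz, one from the number of block lengths and \<open>r\<^sup>1\<^sup>+\<^sup>2\<^sup>\<epsilon>\<close> from summability;
  the square root of their product is the exponent \<open>3/2 + \<epsilon>\<close> of the logarithm.

  The dyadic argument needs increments that are linear in the length of a block.  It is therefore
  applied along the times at which \<open>\<Phi>\<close> first reaches \<open>0, 1, 2, \<dots>\<close>.  Both counts are monotone and
  \<open>\<Phi>\<close> has steps at most \<open>1\<close>, so interpolating between these times costs \<open>O(1)\<close>.  If \<open>\<Phi>\<close> is bounded, the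
  Borel-Cantelli lemma takes the place of this argument.
\<close>

section \<open>The error term\<close>

definition koksma_error :: "real \<Rightarrow> real \<Rightarrow> real" where
  "koksma_error \<epsilon> t = t powr (1/2) * ln (t + 2) powr (3/2 + \<epsilon>)"

lemma koksma_error_nonneg: "koksma_error \<epsilon> t \<ge> 0"
  by (simp add: koksma_error_def)

lemma koksma_error_pos: "t > 0 \<Longrightarrow> koksma_error \<epsilon> t > 0"
  by (simp add: koksma_error_def)

lemma koksma_error_mono:
  assumes "\<epsilon> > 0" "0 \<le> s" "s \<le> t"
  shows "koksma_error \<epsilon> s \<le> koksma_error \<epsilon> t"
  unfolding koksma_error_def using assms
  by (intro mult_mono powr_mono2) auto

text \<open>
  The logarithm at most doubles because \<open>2t + 2 \<le> (t + 2)\<^sup>2\<close>.  Doubling the argument is what rounding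
  \<open>\<Phi>(N) \<ge> 1\<close> up to the next integer may cost.
\<close>

lemma koksma_error_double:
  assumes "\<epsilon> > 0" "0 \<le> t"
  shows "koksma_error \<epsilon> (2 * t) \<le> 2 powr (1/2) * 2 powr (3/2 + \<epsilon>) * koksma_error \<epsilon> t"
proof -
  have "ln (2 * t + 2) \<le> ln ((t + 2)\<^sup>2)"
  proof (rule ln_mono)
    show "2 * t + 2 \<le> (t + 2)\<^sup>2" using assms by (simp add: power2_eq_square algebra_simps)
  qed (use assms in auto)
  also have "\<dots> = 2 * ln (t + 2)" using assms by (simp add: ln_realpow)
  finally have "ln (2 * t + 2) powr (3/2 + \<epsilon>) \<le> (2 * ln (t + 2)) powr (3/2 + \<epsilon>)"
    using assms by (intro powr_mono2) auto
  also have "\<dots> = 2 powr (3/2 + \<epsilon>) * ln (t + 2) powr (3/2 + \<epsilon>)"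
    using assms by (simp add: powr_mult)
  finally have "(2 * t) powr (1/2) * ln (2 * t + 2) powr (3/2 + \<epsilon>)
      \<le> (2 * t) powr (1/2) * (2 powr (3/2 + \<epsilon>) * ln (t + 2) powr (3/2 + \<epsilon>))"
    by (rule mult_left_mono) simp
  then show ?thesis
    using assms by (simp add: koksma_error_def powr_mult mult_ac)
qed

text \<open>
  The finitely many remaining \<open>N\<close> are absorbed by enlarging the constant.  The requirement that \<open>e\<close>
  vanish with \<open>g\<close> matters in the application: as long as \<open>\<Phi>(N) = 0\<close>, no constant leaves room for an
  error.
\<close>

lemma eventual_bound_imp_uniform_bound:
  fixes e g :: "nat \<Rightarrow> real"
  assumes g: "\<And>N. g N \<ge> 0" and zero: "\<And>N. g N = 0 \<Longrightarrow> e N = 0"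
    and ev: "eventually (\<lambda>N. \<bar>e N\<bar> \<le> K0 * g N) sequentially"
  shows "\<exists>K>0. \<forall>N. \<bar>e N\<bar> \<le> K * g N"
proof -
  from ev obtain N0 where N0: "\<And>N. N \<ge> N0 \<Longrightarrow> \<bar>e N\<bar> \<le> K0 * g N"
    by (auto simp: eventually_sequentially)
  define R where "R = (\<Sum>N<N0. \<bar>e N\<bar> / g N)"
  have R0: "R \<ge> 0" unfolding R_def using g by (intro sum_nonneg) auto
  have "\<bar>e N\<bar> \<le> (1 + \<bar>K0\<bar> + R) * g N" for N
  proof (cases "N < N0 \<and> g N \<noteq> 0")
    case True
    have "\<bar>e N\<bar> / g N \<le> R"
      unfolding R_def using True g by (intro member_le_sum) auto
    then have "\<bar>e N\<bar> \<le> R * g N"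
      using True g[of N] by (simp add: field_simps)
    also have "\<dots> \<le> (1 + \<bar>K0\<bar> + R) * g N"
      using g by (intro mult_right_mono) auto
    finally show ?thesis .
  next
    case False
    have "\<bar>e N\<bar> \<le> \<bar>K0\<bar> * g N"
    proof (cases "g N = 0")
      case nz: False
      have "\<bar>e N\<bar> \<le> K0 * g N" using False nz by (intro N0) auto
      also have "\<dots> \<le> \<bar>K0\<bar> * g N" using g by (intro mult_right_mono) auto
      finally show ?thesis .
    qed (simp add: zero)
    also have "\<dots> \<le> (1 + \<bar>K0\<bar> + R) * g N"
      using g R0 by (intro mult_right_mono) auto
    finally show ?thesis .
  qed
  then show ?thesis using R0 by (intro exI[of _ "1 + \<bar>K0\<bar> + R"]) auto
qed

section \<open>The strong law of Gal and Koksma\<close>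

text \<open>
  Clear the binary digits of \<open>j\<close> one at a time, starting with the lowest.  Clearing digit \<open>s\<close> does
  nothing if it is \<open>0\<close>, and otherwise moves from the right to the left end of one dyadic block of length
  \<open>2\<^sup>s\<close>.
\<close>

lemma dyadic_chaining:
  fixes S :: "nat \<Rightarrow> real"
  assumes "j < 2 ^ r"
  shows "(S j - S 0)\<^sup>2 \<le> r * (\<Sum>s<r. \<Sum>i<2 ^ (r - s). (S ((i + 1) * 2 ^ s) - S (i * 2 ^ s))\<^sup>2)"
proof -
  \<comment> \<open>\<open>j div 2 ^ s * 2 ^ s\<close> is \<open>j\<close> with its lowest \<open>s\<close> binary digits cleared.\<close>
  define D where "D s = S (j div 2 ^ s * 2 ^ s) - S (j div 2 ^ Suc s * 2 ^ Suc s)" for s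
  have D_le: "(D s)\<^sup>2 \<le> (\<Sum>i<2 ^ (r - s). (S ((i + 1) * 2 ^ s) - S (i * 2 ^ s))\<^sup>2)"
    if "s < r" for s
  proof -
    define q where "q = j div 2 ^ s"
    have q2: "j div 2 ^ Suc s = q div 2"
      unfolding q_def by (metis div_mult2_eq power_Suc2)
    show ?thesis
    proof (cases "even q")
      case True
      then have "q div 2 * 2 ^ Suc s = q * 2 ^ s" by simp
      then have "D s = 0"
        unfolding D_def q2 q_def[symmetric] by (simp only: diff_self)
      then show ?thesis by (simp add: sum_nonneg)
    next
      case False
      then obtain p where p: "q = 2 * p + 1" by (elim oddE)
      have "D s = S ((2 * p + 1) * 2 ^ s) - S (2 * p * 2 ^ s)"
        unfolding D_def q2 q_def[symmetric] p by (simp add: algebra_simps)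
      moreover have "q < 2 ^ (r - s)"
        unfolding q_def using assms that
        by (simp add: less_mult_imp_div_less power_add[symmetric])
      then have "2 * p \<in> {..<2 ^ (r - s)}" using p by simp
      ultimately show ?thesis
        using member_le_sum[of "2 * p" "{..<2 ^ (r - s)}"
            "\<lambda>i. (S ((i + 1) * 2 ^ s) - S (i * 2 ^ s))\<^sup>2"] by simp
    qed
  qed
  have "(\<Sum>s<r. D s) = S j - S (j div 2 ^ r * 2 ^ r)"
    unfolding D_def by (subst sum_lessThan_telescope') simp
  then have "(S j - S 0)\<^sup>2 = (\<Sum>s<r. D s)\<^sup>2" using assms by simp
  also have "\<dots> \<le> r * (\<Sum>s<r. (D s)\<^sup>2)"
    using sum_squared_le_sum_of_squares[of D "{..<r}"] by (simp add: mult.commute)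
  also have "\<dots> \<le> r * (\<Sum>s<r. \<Sum>i<2 ^ (r - s). (S ((i + 1) * 2 ^ s) - S (i * 2 ^ s))\<^sup>2)"
    by (intro mult_left_mono sum_mono D_le) auto
  finally show ?thesis .
qed

text \<open>
  By monotone convergence the sum of the series has finite expectation.
\<close>

lemma AE_summable_of_summable_integral:
  fixes Y :: "nat \<Rightarrow> 'a \<Rightarrow> real"
  assumes int: "\<And>n. integrable M (Y n)" and nn: "\<And>n x. Y n x \<ge> 0"
    and sm: "summable (\<lambda>n. integral\<^sup>L M (Y n))"
  shows "AE x in M. summable (\<lambda>n. Y n x)"
proof -
  have meas: "Y n \<in> borel_measurable M" for n by (rule borel_measurable_integrable[OF int])
  have "(\<integral>\<^sup>+x. (\<Sum>n. ennreal (Y n x)) \<partial>M) = (\<Sum>n. \<integral>\<^sup>+x. ennreal (Y n x) \<partial>M)"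
    using meas by (intro nn_integral_suminf) auto
  also have "\<dots> = (\<Sum>n. ennreal (integral\<^sup>L M (Y n)))"
    using nn int by (intro suminf_cong nn_integral_eq_integral) auto
  also have "\<dots> \<noteq> \<infinity>"
    by (subst suminf_ennreal2[OF _ sm]) (auto intro: Bochner_Integration.integral_nonneg nn)
  finally have "AE x in M. (\<Sum>n. ennreal (Y n x)) \<noteq> \<infinity>"
    using meas by (intro nn_integral_noteq_infinite) auto
  then show ?thesis
    by (rule eventually_mono) (use nn in \<open>auto intro: summable_suminf_not_top\<close>)
qed

text \<open>
  Let \<open>Y\<^sub>r\<close> be the sum of the squared increments over all dyadic blocks inside \<open>[0, 2\<^sup>r]\<close> of length less
  than \<open>2\<^sup>r\<close>.  Once \<open>Y\<^sub>r / w\<^sub>r\<close> is almost surely bounded in \<open>r\<close>, the conclusion is deterministic: chain to \<open>j\<close>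
  with \<open>2\<^sup>r\<close> the least power of \<open>2\<close> above \<open>j\<close>.  The weight \<open>w\<^sub>r\<close> exceeds the expectation of \<open>Y\<^sub>r\<close>
  by a factor \<open>r\<^sup>1\<^sup>+\<^sup>2\<^sup>\<epsilon>\<close>, up to a constant, which makes the expected ratios summable.
\<close>

lemma gal_koksma_strong_law:
  fixes S :: "nat \<Rightarrow> 'a \<Rightarrow> real"
  assumes int: "\<And>a b. a < b \<Longrightarrow> integrable M (\<lambda>x. (S b x - S a x)\<^sup>2)"
    and var: "\<And>a b. a < b \<Longrightarrow> (\<integral>x. (S b x - S a x)\<^sup>2 \<partial>M) \<le> C * real (b - a)"
    and \<epsilon>: "\<epsilon> > 0"
  shows "AE x in M. \<exists>K. \<forall>j. \<bar>S j x - S 0 x\<bar> \<le> K * koksma_error \<epsilon> (real j)"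
proof -
  define Y where "Y r x = (\<Sum>s<r. \<Sum>i<2 ^ (r - s). (S ((i + 1) * 2 ^ s) x - S (i * 2 ^ s) x)\<^sup>2)"
    for r :: nat and x
  define w where "w r = 2 ^ r * real r powr (2 + 2 * \<epsilon>)" for r :: nat
  have w_nn: "w r \<ge> 0" for r by (simp add: w_def)
  have Y_nn: "Y r x \<ge> 0" for r x by (simp add: Y_def sum_nonneg)
  have int': "integrable M (\<lambda>x. (S ((i + 1) * 2 ^ s) x - S (i * 2 ^ s) x)\<^sup>2)" for i s :: nat
    by (rule int) simp
  have Y_int: "integrable M (Y r)" for r
    unfolding Y_def by (intro Bochner_Integration.integrable_sum int')
  have EY: "integral\<^sup>L M (Y r) \<le> C * r * 2 ^ r" for r
  proof -
    have "integral\<^sup>L M (Y r) = (\<Sum>s<r. \<Sum>i<2 ^ (r - s). \<integral>x. (S ((i + 1) * 2 ^ s) x - S (i * 2 ^ s) x)\<^sup>2 \<partial>M)"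
      unfolding Y_def
      by (subst Bochner_Integration.integral_sum, intro Bochner_Integration.integrable_sum int',
          intro sum.cong refl Bochner_Integration.integral_sum int')
    also have "\<dots> \<le> (\<Sum>s<r. \<Sum>i<(2::nat) ^ (r - s). C * 2 ^ s)"
    proof (intro sum_mono)
      fix s i :: nat
      show "(\<integral>x. (S ((i + 1) * 2 ^ s) x - S (i * 2 ^ s) x)\<^sup>2 \<partial>M) \<le> C * 2 ^ s"
        using var[of "i * 2 ^ s" "(i + 1) * 2 ^ s"] by (simp add: algebra_simps)
    qed
    also have "\<dots> = (\<Sum>s<r. C * 2 ^ r)"
      by (intro sum.cong) (auto simp: power_add[symmetric])
    finally show ?thesis by (simp add: mult_ac)
  qed
  have "summable (\<lambda>r. integral\<^sup>L M (\<lambda>x. Y r x / w r))"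
  proof (rule summable_comparison_test)
    show "summable (\<lambda>r. C * real r powr (- 1 - 2 * \<epsilon>))"
      using \<epsilon> by (intro summable_mult) (simp add: summable_real_powr_iff)
    show "\<exists>N. \<forall>r\<ge>N. norm (integral\<^sup>L M (\<lambda>x. Y r x / w r)) \<le> C * real r powr (- 1 - 2 * \<epsilon>)"
    proof (intro exI allI impI)
      fix r :: nat assume r: "1 \<le> r"
      have "norm (integral\<^sup>L M (\<lambda>x. Y r x / w r)) = integral\<^sup>L M (Y r) / w r"
        using Y_nn w_nn by (simp add: integral_nonneg)
      also have "\<dots> \<le> C * r * 2 ^ r / w r"
        using w_nn EY by (intro divide_right_mono) auto
      also have "\<dots> = C * (r powr 1 / r powr (2 + 2 * \<epsilon>))"
        using r by (simp add: w_def)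
      also have "\<dots> = C * real r powr (- 1 - 2 * \<epsilon>)"
        by (subst powr_diff[symmetric]) simp
      finally show "norm (integral\<^sup>L M (\<lambda>x. Y r x / w r)) \<le> C * real r powr (- 1 - 2 * \<epsilon>)" .
    qed
  qed
  then have "AE x in M. summable (\<lambda>r. Y r x / w r)"
    using Y_nn w_nn Y_int by (intro AE_summable_of_summable_integral) auto
  then show ?thesis
  proof (rule AE_mp, intro AE_I2 impI)
    fix x assume sm: "summable (\<lambda>r. Y r x / w r)"
    define L where "L = (\<Sum>r. Y r x / w r)"
    have L: "Y r x / w r \<le> L" for r
      using sum_le_suminf[OF sm, of "{r}"] Y_nn w_nn by (simp add: L_def)
    have L0: "L \<ge> 0" using L[of 0] Y_nn[of 0 x] w_nn[of 0] by (meson divide_nonneg_nonneg order_trans)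
    \<comment> \<open>This constant converts the number \<open>r\<close> of binary digits of \<open>j\<close> into \<open>ln (j + 2)\<close>.\<close>
    define c where "c = 2 / ln (2::real)"
    have c0: "c > 0" by (simp add: c_def)
    show "\<exists>K. \<forall>j. \<bar>S j x - S 0 x\<bar> \<le> K * koksma_error \<epsilon> (real j)"
      unfolding koksma_error_def
    proof (intro exI allI)
      fix j :: nat
      show "\<bar>S j x - S 0 x\<bar> \<le> (sqrt (2 * L) * c powr (3/2 + \<epsilon>)) * (real j powr (1/2) * ln (real j + 2) powr (3/2 + \<epsilon>))"
      proof (cases "j = 0")
        case False
        then have "\<exists>k. 2 ^ k \<le> j \<and> j < 2 ^ (k + 1)"
          by (intro ex_power_ivl1) auto
        then obtain k where k: "2 ^ k \<le> j" "j < 2 ^ (k + 1)" by blast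
        define r where "r = k + 1"
        have r: "j < 2 ^ r" "2 ^ r \<le> 2 * real j" "r > 0"
          using k of_nat_mono[OF k(1), where 'a = real] unfolding r_def by auto
        have "real r * ln 2 = ln (2 ^ r)" by (simp add: ln_realpow)
        also have "\<dots> \<le> ln ((real j + 2)\<^sup>2)"
        proof -
          have "2 * real j \<le> (real j + 2)\<^sup>2" by (simp add: power2_eq_square algebra_simps)
          then show ?thesis using r(2) by (intro ln_mono) (auto intro: order.trans)
        qed
        also have "\<dots> = 2 * ln (real j + 2)" by (simp add: ln_realpow)
        finally have rc: "real r \<le> c * ln (real j + 2)"
          by (simp add: c_def field_simps)
        have ln0: "ln (real j + 2) > 0" by simp
        have "(S j x - S 0 x)\<^sup>2 \<le> r * Y r x"
          unfolding Y_def by (rule dyadic_chaining[OF r(1)])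
        also have "\<dots> \<le> r * (L * w r)"
          using L[of r] r(3) by (intro mult_left_mono) (auto simp: w_def field_simps)
        also have "\<dots> = L * 2 ^ r * r powr (3 + 2 * \<epsilon>)"
        proof -
          have "real r powr (3 + 2 * \<epsilon>) = r powr 1 * r powr (2 + 2 * \<epsilon>)"
            by (subst powr_add[symmetric]) simp
          then show ?thesis using r(3) by (simp add: w_def)
        qed
        also have "\<dots> \<le> L * (2 * real j) * (c * ln (real j + 2)) powr (3 + 2 * \<epsilon>)"
          using L0 r(2) rc \<epsilon> by (intro mult_mono powr_mono2) auto
        also have "\<dots> = ((sqrt (2 * L) * c powr (3/2 + \<epsilon>)) * (real j powr (1/2) * ln (real j + 2) powr (3/2 + \<epsilon>)))\<^sup>2"
        proof -
          have sq: "(a powr (3/2 + \<epsilon>))\<^sup>2 = a powr (3 + 2 * \<epsilon>)" for a :: real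
            by (simp add: power2_eq_square powr_add[symmetric] algebra_simps)
          show ?thesis
            using L0 c0 ln0 by (simp add: power_mult_distrib sq powr_mult powr_half_sqrt mult_ac)
        qed
        finally show ?thesis
          using L0 by (intro abs_le_square_iff[THEN iffD2, THEN order.trans, OF _ eq_refl[OF abs_of_nonneg]]) auto
      qed simp
    qed
  qed
qed

section \<open>Events with exponentially decaying correlations\<close>

lemma (in prob_space) square_sum_indicator_integrable:
  assumes "\<And>k. E k \<in> events"
  shows "integrable M (\<lambda>x. (\<Sum>k\<in>A. indicator (E k) x - prob (E k))\<^sup>2)"
proof (cases "finite A")
  case True
  show ?thesis
  proof (rule integrable_const_bound)
    show "AE x in M. norm ((\<Sum>k\<in>A. indicator (E k) x - prob (E k))\<^sup>2) \<le> (real (card A))\<^sup>2"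
    proof (rule AE_I2)
      fix x
      have "\<bar>indicator (E k) x - prob (E k)\<bar> \<le> 1" for k
        using prob_le_1[of "E k"] measure_nonneg[of M "E k"] by (auto simp: indicator_def)
      then have "\<bar>\<Sum>k\<in>A. indicator (E k) x - prob (E k)\<bar> \<le> real (card A)"
        using sum_norm_bound[of A "\<lambda>k. indicator (E k) x - prob (E k)" 1] by simp
      then have "\<bar>\<Sum>k\<in>A. indicator (E k) x - prob (E k)\<bar>\<^sup>2 \<le> (real (card A))\<^sup>2"
        by (rule power_mono) simp
      then show "norm ((\<Sum>k\<in>A. indicator (E k) x - prob (E k))\<^sup>2) \<le> (real (card A))\<^sup>2" by simp
    qed
    show "(\<lambda>x. (\<Sum>k\<in>A. indicator (E k) x - prob (E k))\<^sup>2) \<in> borel_measurable M"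
      using assms by measurable
  qed
qed simp

text \<open>
  Adding the event \<open>E\<^sub>b\<close> to a block adds the variance of its indicator, which is at most its
  probability, and twice its covariances with the earlier events.  The latter decay geometrically in
  the distance and all carry the factor \<open>prob (E\<^sub>b)\<close>, so they sum to at most
  \<open>C / (1 - \<gamma>)\<close> times that probability.
\<close>

lemma (in prob_space) second_moment_le:
  fixes E :: "nat \<Rightarrow> 'a set"
  assumes E: "\<And>k. E k \<in> events"
    and \<gamma>: "0 < \<gamma>" "\<gamma> < 1" and C: "C > 0"
    and corr: "\<And>m n. m < n \<Longrightarrow>
       prob (E m \<inter> E n) \<le> prob (E m) * prob (E n) + C * \<gamma> ^ (n - m) * prob (E n)"
    and ab: "a \<le> b"
  shows "expectation (\<lambda>x. (\<Sum>k\<in>{a..<b}. indicator (E k) x - prob (E k))\<^sup>2)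
           \<le> (1 + 2 * C / (1 - \<gamma>)) * (\<Sum>k\<in>{a..<b}. prob (E k))"
  using ab
proof (induction b rule: dec_induct)
  case base
  show ?case by simp
next
  case (step b)
  define h where "h k x = indicator (E k) x - prob (E k)" for k x
  define p where "p k = prob (E k)" for k
  define F where "F x = (\<Sum>k\<in>{a..<b}. h k x)" for x
  have ins: "{a..<Suc b} = insert b {a..<b}" using step by auto
  have prod: "h k x * h m x = indicator (E k \<inter> E m) x - p k * indicator (E m) x
      - p m * indicator (E k) x + p k * p m" for k m x
    by (simp add: h_def p_def indicator_inter_arith algebra_simps)
  have int_ind: "integrable M (indicator A :: 'a \<Rightarrow> real)" if "A \<in> events" for A
    using that by (simp add: integrable_indicator_iff less_top[symmetric])
  have hh_int: "integrable M (\<lambda>x. h k x * h m x)" for k m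
    unfolding prod using E
    by (intro Bochner_Integration.integrable_add Bochner_Integration.integrable_diff
        integrable_mult_right integrable_const int_ind sets.Int) auto
  have hh: "expectation (\<lambda>x. h k x * h m x) = prob (E k \<inter> E m) - p k * p m" for k m
    unfolding prod using E
    by (simp add: int_ind p_def prob_space)
  have F2: "(F x)\<^sup>2 = (\<Sum>k\<in>{a..<b}. \<Sum>m\<in>{a..<b}. h k x * h m x)" for x
    by (simp add: F_def power2_eq_square sum_product)
  have F2_int: "integrable M (\<lambda>x. (F x)\<^sup>2)"
    unfolding F2 by (intro Bochner_Integration.integrable_sum hh_int)
  have exp: "(\<Sum>k\<in>{a..<Suc b}. h k x)\<^sup>2
      = (F x)\<^sup>2 + (2 * (\<Sum>k\<in>{a..<b}. h k x * h b x) + h b x * h b x)" for x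
    unfolding ins by (simp add: F_def sum_distrib_right[symmetric] power2_eq_square algebra_simps)
  have cross_int: "integrable M (\<lambda>x. 2 * (\<Sum>k\<in>{a..<b}. h k x * h b x))"
    by (intro integrable_mult_right Bochner_Integration.integrable_sum hh_int)
  have "expectation (\<lambda>x. \<Sum>k\<in>{a..<b}. h k x * h b x)
      = (\<Sum>k\<in>{a..<b}. prob (E k \<inter> E b) - p k * p b)"
    by (subst Bochner_Integration.integral_sum) (auto intro!: hh_int sum.cong hh)
  also have "\<dots> \<le> (\<Sum>k\<in>{a..<b}. C * p b * \<gamma> ^ (b - k))"
  proof (rule sum_mono)
    fix k assume "k \<in> {a..<b}"
    then show "prob (E k \<inter> E b) - p k * p b \<le> C * p b * \<gamma> ^ (b - k)"
      using corr[of k "b"] by (auto simp: p_def algebra_simps)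
  qed
  also have "\<dots> = C * p b * (\<Sum>k\<in>{a..<b}. \<gamma> ^ (b - k))"
    by (simp add: sum_distrib_left)
  also have "(\<Sum>k\<in>{a..<b}. \<gamma> ^ (b - k)) = (\<Sum>i\<in>(\<lambda>k. b - k) ` {a..<b}. \<gamma> ^ i)"
    by (subst sum.reindex) (auto simp: inj_on_def)
  also have "\<dots> \<le> (\<Sum>i. \<gamma> ^ i)"
    using \<gamma> by (intro sum_le_suminf) auto
  also have "\<dots> = 1 / (1 - \<gamma>)" using \<gamma> by (intro suminf_geometric) auto
  finally have cross: "expectation (\<lambda>x. \<Sum>k\<in>{a..<b}. h k x * h b x) \<le> C * p b * (1 / (1 - \<gamma>))"
    using C by (simp add: p_def mult_left_mono)
  have diag: "expectation (\<lambda>x. h b x * h b x) \<le> p b"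
    by (subst hh) (auto simp: p_def)
  have "expectation (\<lambda>x. (\<Sum>k\<in>{a..<Suc b}. h k x)\<^sup>2)
      = expectation (\<lambda>x. (F x)\<^sup>2) + (2 * expectation (\<lambda>x. \<Sum>k\<in>{a..<b}. h k x * h b x)
          + expectation (\<lambda>x. h b x * h b x))"
    unfolding exp using F2_int cross_int hh_int[of "b" "b"]
    by (simp add: Bochner_Integration.integral_add Bochner_Integration.integrable_add)
  also have "\<dots> \<le> (1 + 2 * C / (1 - \<gamma>)) * (\<Sum>k\<in>{a..<b}. p k) + (2 * (C * p b * (1 / (1 - \<gamma>))) + p b)"
    using step.IH cross diag by (intro add_mono mult_left_mono) (auto simp: F_def h_def p_def)
  also have "\<dots> = (1 + 2 * C / (1 - \<gamma>)) * (\<Sum>k\<in>{a..<Suc b}. p k)"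
    unfolding ins by (simp add: algebra_simps add_divide_distrib)
  finally show ?case by (simp add: h_def p_def)
qed

text \<open>
  The strong law is applied to the centred counts at the times \<open>\<nu> j\<close>, where \<open>\<Phi>\<close> first reaches \<open>j\<close>.
  Since \<open>j \<le> \<Phi> (\<nu> j) < j + 1\<close>, the \<open>\<Phi>\<close>-mass between \<open>\<nu> a\<close> and \<open>\<nu> b\<close> is less than
  \<open>b - a + 1 \<le> 2 (b - a)\<close> for \<open>a < b\<close>.  A constant \<open>K\<close> independent of \<open>N\<close> also has to serve those \<open>N\<close> with
  \<open>\<Phi> N = 0\<close>; for these the count is almost surely \<open>0\<close>.
\<close>

lemma (in prob_space) quasi_independent_event_count:
  fixes E :: "nat \<Rightarrow> 'a set"
  assumes E: "\<And>k. E k \<in> events"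
    and \<gamma>: "0 < \<gamma>" "\<gamma> < 1" and C: "C > 0"
    and corr: "\<And>m n. m < n \<Longrightarrow>
       prob (E m \<inter> E n) \<le> prob (E m) * prob (E n) + C * \<gamma> ^ (n - m) * prob (E n)"
    and \<epsilon>: "\<epsilon> > 0"
  shows "AE x in M. \<exists>K>0. \<forall>N. \<bar>(\<Sum>n<N. indicator (E n) x) - (\<Sum>n<N. prob (E n))\<bar>
            \<le> K * koksma_error \<epsilon> (\<Sum>n<N. prob (E n))"
proof -
  define \<Phi> where "\<Phi> N = (\<Sum>n<N. prob (E n))" for N
  define W :: "'a \<Rightarrow> nat \<Rightarrow> real" where "W x N = (\<Sum>n<N. indicator (E n) x)" for x N
  have \<Phi>_mono: "\<Phi> a \<le> \<Phi> b" if "a \<le> b" for a b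
    unfolding \<Phi>_def using that by (intro sum_mono2) auto
  have W_mono: "W x a \<le> W x b" if "a \<le> b" for a b x
    unfolding W_def using that by (intro sum_mono2) auto
  have \<Phi>_nn: "\<Phi> N \<ge> 0" for N unfolding \<Phi>_def by (intro sum_nonneg) auto
  have W_nn: "W x N \<ge> 0" for x N unfolding W_def by (intro sum_nonneg) auto

  have "AE x in M. \<forall>n. prob (E n) = 0 \<longrightarrow> x \<notin> E n"
  proof (subst AE_all_countable, intro allI)
    fix n
    show "AE x in M. prob (E n) = 0 \<longrightarrow> x \<notin> E n"
    proof (cases "prob (E n) = 0")
      case True
      then have "E n \<in> null_sets M"
        using E[of n] by (auto simp: null_sets_def emeasure_eq_measure)
      then have "AE x in M. x \<notin> E n" by (rule AE_not_in)
      then show ?thesis by eventually_elim simp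
    qed simp
  qed
  then have zero: "AE x in M. \<forall>N. \<Phi> N = 0 \<longrightarrow> W x N = 0"
  proof eventually_elim
    case (elim x)
    show ?case
    proof (intro allI impI)
      fix N assume "\<Phi> N = 0"
      then have "\<forall>n\<in>{..<N}. prob (E n) = 0"
        unfolding \<Phi>_def by (subst (asm) sum_nonneg_eq_0_iff) auto
      then show "W x N = 0" unfolding W_def using elim by (intro sum.neutral) auto
    qed
  qed

  have "AE x in M. \<exists>K. eventually (\<lambda>N. \<bar>W x N - \<Phi> N\<bar> \<le> K * koksma_error \<epsilon> (\<Phi> N)) sequentially"
  proof (cases "\<exists>b. \<forall>N. \<Phi> N \<le> b")
    case True
    then obtain b where b: "\<And>N. \<Phi> N \<le> b" by blast
    have sm: "summable (\<lambda>n. prob (E n))"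
      using b unfolding \<Phi>_def by (intro summableI_nonneg_bounded[where x = b]) auto
    have "AE x in M. eventually (\<lambda>n. x \<in> space M - E n) sequentially"
      by (rule borel_cantelli_AE1[OF E _ sm]) (simp add: less_top[symmetric])
    with zero show ?thesis
    proof eventually_elim
      case (elim x)
      \<comment> \<open>Both the count and \<open>\<Phi>\<close> are bounded here, so it suffices that the error term is eventually
        bounded away from \<open>0\<close>, unless \<open>\<Phi>\<close> vanishes identically.\<close>
      obtain n0 where n0: "\<And>n. n \<ge> n0 \<Longrightarrow> x \<notin> E n"
        using elim(2) by (auto simp: eventually_sequentially)
      have Wc: "W x N = W x n0" if "N \<ge> n0" for N
        unfolding W_def using that n0 by (intro sum.mono_neutral_right) auto
      show ?case
      proof (cases "\<forall>N. \<Phi> N = 0")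
        case True
        then show ?thesis using elim(1) by (intro exI[of _ 0]) simp
      next
        case False
        then obtain N1 where "\<Phi> N1 > 0" using \<Phi>_nn by (metis less_eq_real_def)
        then have g1: "koksma_error \<epsilon> (\<Phi> N1) > 0" by (rule koksma_error_pos)
        have "\<bar>W x N - \<Phi> N\<bar> \<le> (W x n0 + b) / koksma_error \<epsilon> (\<Phi> N1) * koksma_error \<epsilon> (\<Phi> N)"
          if N: "N \<ge> max n0 N1" for N
        proof -
          have "\<bar>W x N - \<Phi> N\<bar> \<le> W x n0 + b"
            using Wc[of N] N b[of N] W_nn[of x n0] \<Phi>_nn[of N] by auto
          also have "\<dots> = (W x n0 + b) / koksma_error \<epsilon> (\<Phi> N1) * koksma_error \<epsilon> (\<Phi> N1)"
            using g1 by simp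
          also have "\<dots> \<le> (W x n0 + b) / koksma_error \<epsilon> (\<Phi> N1) * koksma_error \<epsilon> (\<Phi> N)"
            using N g1 W_nn[of x n0] b[of 0] \<Phi>_nn[of 0] \<epsilon>
            by (intro mult_left_mono koksma_error_mono \<Phi>_mono \<Phi>_nn) auto
          finally show ?thesis .
        qed
        then show ?thesis unfolding eventually_sequentially by blast
      qed
    qed
  next
    case False
    then have unb: "\<exists>n. b \<le> \<Phi> n" for b by (meson linear)
    define \<nu> where "\<nu> j = (LEAST n. real j \<le> \<Phi> n)" for j :: nat
    have \<nu>_ge: "real j \<le> \<Phi> (\<nu> j)" for j
      unfolding \<nu>_def by (rule LeastI_ex[OF unb])
    have \<nu>_le: "\<nu> j \<le> n" if "real j \<le> \<Phi> n" for j n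
      unfolding \<nu>_def using that by (rule Least_le)
    have \<nu>_lt: "\<Phi> (\<nu> j) < real j + 1" for j
    proof (cases "\<nu> j")
      case 0
      then show ?thesis by (simp add: \<Phi>_def)
    next
      case (Suc m)
      then have "\<Phi> m < real j" using \<nu>_le[of j m] by force
      moreover have "\<Phi> (Suc m) = \<Phi> m + prob (E m)" by (simp add: \<Phi>_def)
      ultimately show ?thesis unfolding Suc using prob_le_1[of "E m"] by linarith
    qed
    have \<nu>_mono: "\<nu> a \<le> \<nu> b" if "a \<le> b" for a b
      using \<nu>_ge[of b] that by (intro \<nu>_le) simp
    define S where "S j x = W x (\<nu> j) - \<Phi> (\<nu> j)" for j x
    have "\<nu> 0 = 0" using \<nu>_le[of 0 0] \<Phi>_nn by simp
    then have S0: "S 0 x = 0" for x by (simp add: S_def W_def \<Phi>_def)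
    have S_diff: "S b x - S a x = (\<Sum>k\<in>{\<nu> a..<\<nu> b}. indicator (E k) x - prob (E k))"
      if "a < b" for a b x
    proof -
      have "(\<Sum>k\<in>{\<nu> a..<\<nu> b}. indicator (E k) x - prob (E k))
          = (\<Sum>k\<in>{0..<\<nu> b}. indicator (E k) x - prob (E k)) - (\<Sum>k\<in>{0..<\<nu> a}. indicator (E k) x - prob (E k))"
        using \<nu>_mono[of a b] that by (subst sum_diff_nat_ivl) auto
      then show ?thesis
        by (simp add: S_def W_def \<Phi>_def sum_subtractf atLeast0LessThan)
    qed
    define D where "D = 1 + 2 * C / (1 - \<gamma>)"
    have D0: "D \<ge> 0" using C \<gamma> by (simp add: D_def)
    have "AE x in M. \<exists>K. \<forall>j. \<bar>S j x - S 0 x\<bar> \<le> K * koksma_error \<epsilon> (real j)"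
    proof (rule gal_koksma_strong_law[OF _ _ \<epsilon>])
      fix a b :: nat assume ab: "a < b"
      show "integrable M (\<lambda>x. (S b x - S a x)\<^sup>2)"
        unfolding S_diff[OF ab] using E by (intro square_sum_indicator_integrable)
      have "(\<integral>x. (S b x - S a x)\<^sup>2 \<partial>M) \<le> D * (\<Sum>k\<in>{\<nu> a..<\<nu> b}. prob (E k))"
        unfolding S_diff[OF ab] D_def
        using ab by (intro second_moment_le E \<gamma> C corr \<nu>_mono) auto
      also have "(\<Sum>k\<in>{\<nu> a..<\<nu> b}. prob (E k)) = \<Phi> (\<nu> b) - \<Phi> (\<nu> a)"
        unfolding \<Phi>_def lessThan_atLeast0 using \<nu>_mono[of a b] ab by (subst sum_diff_nat_ivl) auto
      also have "D * (\<Phi> (\<nu> b) - \<Phi> (\<nu> a)) \<le> D * (2 * real (b - a))"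
        using \<nu>_lt[of b] \<nu>_ge[of a] ab D0 by (intro mult_left_mono) auto
      finally show "(\<integral>x. (S b x - S a x)\<^sup>2 \<partial>M) \<le> (2 * D) * real (b - a)" by simp
    qed
    then show ?thesis
    proof eventually_elim
      case (elim x)
      then obtain K' where "\<And>j. \<bar>S j x\<bar> \<le> K' * koksma_error \<epsilon> (real j)"
        unfolding S0 by auto
      then have K: "\<bar>S j x\<bar> \<le> \<bar>K'\<bar> * koksma_error \<epsilon> (real j)" for j
        by (meson abs_ge_self koksma_error_nonneg mult_right_mono order_trans)
      define c where "c = 2 powr (1/2) * 2 powr (3/2 + \<epsilon>)"
      define K0 where "K0 = \<bar>K'\<bar> * c + 2 / koksma_error \<epsilon> 1"
      have "\<bar>W x N - \<Phi> N\<bar> \<le> K0 * koksma_error \<epsilon> (\<Phi> N)" if N: "\<nu> 1 \<le> N" for N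
      proof -
        have \<Phi>1: "\<Phi> N \<ge> 1" using \<nu>_ge[of 1] \<Phi>_mono[OF N] by simp
        define j where "j = nat \<lfloor>\<Phi> N\<rfloor>"
        have j: "real j \<le> \<Phi> N" "\<Phi> N < real (Suc j)"
          unfolding j_def using \<Phi>1 by linarith+
        have lo: "\<nu> j \<le> N" by (rule \<nu>_le[OF j(1)])
        have hi: "N \<le> \<nu> (Suc j)"
          using \<Phi>_mono[of "\<nu> (Suc j)" N] \<nu>_ge[of "Suc j"] j(2) by (cases "N \<le> \<nu> (Suc j)") auto
        have S_le: "\<bar>S i x\<bar> \<le> \<bar>K'\<bar> * koksma_error \<epsilon> (2 * \<Phi> N)" if "i \<le> Suc j" for i
        proof -
          have "real i \<le> 2 * \<Phi> N" using that j(1) \<Phi>1 by linarith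
          then have "\<bar>K'\<bar> * koksma_error \<epsilon> (real i) \<le> \<bar>K'\<bar> * koksma_error \<epsilon> (2 * \<Phi> N)"
            using \<epsilon> by (intro mult_left_mono koksma_error_mono) auto
          with K[of i] show ?thesis by linarith
        qed
        \<comment> \<open>Comparing with the times \<open>\<nu> j \<le> N \<le> \<nu> (Suc j)\<close> costs at most the \<open>\<Phi>\<close>-mass
          between them, which is less than \<open>2\<close>.\<close>
        have "\<bar>W x N - \<Phi> N\<bar> \<le> \<bar>K'\<bar> * koksma_error \<epsilon> (2 * \<Phi> N) + 2"
          using S_le[of j] S_le[of "Suc j"] W_mono[OF lo, of x] W_mono[OF hi, of x]
            \<Phi>_mono[OF lo] \<Phi>_mono[OF hi] \<nu>_ge[of j] \<nu>_lt[of "Suc j"]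
          unfolding S_def by simp
        also have "\<dots> \<le> \<bar>K'\<bar> * (c * koksma_error \<epsilon> (\<Phi> N)) + 2 / koksma_error \<epsilon> 1 * koksma_error \<epsilon> (\<Phi> N)"
        proof (rule add_mono)
          show "\<bar>K'\<bar> * koksma_error \<epsilon> (2 * \<Phi> N) \<le> \<bar>K'\<bar> * (c * koksma_error \<epsilon> (\<Phi> N))"
            unfolding c_def using \<epsilon> \<Phi>_nn by (intro mult_left_mono koksma_error_double) auto
          show "2 \<le> 2 / koksma_error \<epsilon> 1 * koksma_error \<epsilon> (\<Phi> N)"
            using koksma_error_mono[OF \<epsilon> _ \<Phi>1] koksma_error_pos[of 1 \<epsilon>] by (simp add: field_simps)
        qed
        finally show ?thesis by (simp add: K0_def algebra_simps)
      qed
      then show ?case unfolding eventually_sequentially by blast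
    qed
  qed
  with zero show ?thesis
  proof eventually_elim
    case (elim x)
    then obtain K where
      "eventually (\<lambda>N. \<bar>W x N - \<Phi> N\<bar> \<le> K * koksma_error \<epsilon> (\<Phi> N)) sequentially" by blast
    moreover have "W x N - \<Phi> N = 0" if "koksma_error \<epsilon> (\<Phi> N) = 0" for N
      using that elim(1) \<Phi>_nn[of N] koksma_error_pos[of "\<Phi> N" \<epsilon>] by fastforce
    ultimately show ?case
      unfolding W_def[symmetric] \<Phi>_def[symmetric]
      by (intro eventual_bound_imp_uniform_bound koksma_error_nonneg)
  qed
qed

section \<open>Shrinking targets for exponentially mixing systems\<close>

lemma ball_convention_sets:
  assumes "Metric_space X d" "ball_convention X d B" "prob_mpds X d M T"
  shows "B x r \<in> sets M"
proof -
  interpret Metric_space X d by fact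
  have sp: "space M = X" and bor: "sigma_sets X {U. openin mtopology U} \<subseteq> sets M"
    using assms(3) by (auto simp: prob_mpds_def)
  have opn: "U \<in> sets M" if "openin mtopology U" for U
    using bor that by (auto intro: sigma_sets.Basic)
  show ?thesis
    using assms(2) unfolding ball_convention_def
  proof
    assume "B = mball"
    then show ?thesis by (auto intro: opn)
  next
    assume "B = mcball"
    moreover have "X - mcball x r \<in> sets M"
      using closedin_mcball[of x r] by (intro opn) (auto simp: closedin_def)
    then have "space M - (X - mcball x r) \<in> sets M" by auto
    moreover have "space M - (X - mcball x r) = mcball x r"
      using sp mcball_subset_mspace[of x r] by auto
    ultimately show ?thesis by simp
  qed
qed

lemma measure_preserving_funpow:
  assumes T: "T \<in> measurable M M"
    and pres: "\<And>F. F \<in> sets M \<Longrightarrow> measure M (T -` F \<inter> space M) = measure M F"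
    and F: "F \<in> sets M"
  shows "measure M ((T ^^ n) -` F \<inter> space M) = measure M F"
  using F
proof (induction n arbitrary: F)
  case 0
  then show ?case using sets.sets_into_space by (simp add: Int_absorb2)
next
  case (Suc n)
  have "(T ^^ Suc n) -` F \<inter> space M = (T ^^ n) -` (T -` F \<inter> space M) \<inter> space M"
    using measurable_space[OF measurable_compose_n[OF T, of n]] by auto
  moreover have "T -` F \<inter> space M \<in> sets M" using T Suc.prems by (rule measurable_sets)
  ultimately show ?case by (simp only: Suc.IH pres[OF Suc.prems])
qed

theorem theorem3p1:
  fixes X :: "'a set" and d :: "'a \<Rightarrow> 'a \<Rightarrow> real"
    and B :: "'a \<Rightarrow> real \<Rightarrow> 'a set"
    and M :: "'a measure" and T :: "'a \<Rightarrow> 'a"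
    and \<psi> :: "nat \<Rightarrow> real" and x0 :: 'a and \<epsilon> :: real
  assumes "Metric_space X d"
    and "compact_space (Metric_space.mtopology X d)"
    and "ball_convention X d B"
    and "prob_mpds X d M T"
    and "exponentially_mixing B M T"
    and "\<And>n. n \<ge> 1 \<Longrightarrow> \<psi> n \<ge> 0"
    and "x0 \<in> X"
    and "\<epsilon> > 0"
  shows "AE x in M. \<exists>K>0. \<forall>N\<ge>1.
           \<bar>real (hit_count B T \<psi> x0 x N) - measure_sum B M \<psi> x0 N\<bar>
             \<le> K * (measure_sum B M \<psi> x0 N powr (1/2)
                    * ln (measure_sum B M \<psi> x0 N + 2) powr (3/2 + \<epsilon>))"
proof -
  have sp: "space M = X" and T: "T \<in> measurable M M" and prob: "prob_space M"
    and pres: "\<And>F. F \<in> sets M \<Longrightarrow> measure M (T -` F \<inter> space M) = measure M F"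
    using assms(4) by (auto simp: prob_mpds_def)
  interpret prob_space M by (rule prob)
  note B_sets = ball_convention_sets[OF assms(1,3,4)]
  note pow_pres = measure_preserving_funpow[OF T pres]
  have pow_meas: "T ^^ n \<in> measurable M M" for n
    by (rule measurable_compose_n[OF T])
  obtain C \<gamma> where C: "C > 0" and \<gamma>: "0 < \<gamma>" "\<gamma> < 1"
    and mix: "\<And>n x r F. 1 \<le> n \<Longrightarrow> x \<in> space M \<Longrightarrow> r \<ge> 0 \<Longrightarrow> F \<in> sets M \<Longrightarrow>
       \<bar>measure M (B x r \<inter> ((T ^^ n) -` F \<inter> space M)) - measure M F * measure M (B x r)\<bar>
             \<le> C * \<gamma> ^ n * measure M F"
    using assms(5) unfolding exponentially_mixing_def by blast
  \<comment> \<open>The shift by one matches counting from time \<open>1\<close> with events indexed from \<open>0\<close>.\<close>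
  define E where "E k = (T ^^ Suc k) -` B x0 (\<psi> (Suc k)) \<inter> space M" for k
  have E_sets: "E k \<in> sets M" for k
    unfolding E_def by (rule measurable_sets[OF pow_meas B_sets])
  have E_prob: "prob (E k) = prob (B x0 (\<psi> (Suc k)))" for k
    unfolding E_def by (rule pow_pres[OF _ B_sets])
  have corr: "prob (E m \<inter> E n) \<le> prob (E m) * prob (E n) + C * \<gamma> ^ (n - m) * prob (E n)"
    if "m < n" for m n
  proof -
    \<comment> \<open>Pulling \<open>T ^^ Suc m\<close> out of the intersection leaves a ball and a preimage under
      \<open>T ^^ (n - m)\<close>, to which mixing applies.\<close>
    let ?A = "B x0 (\<psi> (Suc m))" and ?F = "B x0 (\<psi> (Suc n))"
    let ?G = "?A \<inter> ((T ^^ (n - m)) -` ?F \<inter> space M)"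
    have "T ^^ Suc n = (T ^^ (n - m)) \<circ> (T ^^ Suc m)"
      using that by (subst funpow_add[symmetric]) simp
    then have "E m \<inter> E n = (T ^^ Suc m) -` ?G \<inter> space M"
      unfolding E_def using measurable_space[OF pow_meas[of "Suc m"]] by auto
    moreover have "?G \<in> sets M"
      by (rule sets.Int[OF B_sets measurable_sets[OF pow_meas B_sets]])
    ultimately have "prob (E m \<inter> E n) = prob ?G"
      by (simp only: pow_pres)
    moreover have "\<bar>prob ?G - prob ?F * prob ?A\<bar> \<le> C * \<gamma> ^ (n - m) * prob ?F"
      using that assms(6,7) sp by (intro mix B_sets) auto
    ultimately show ?thesis
      unfolding E_prob by (simp add: abs_le_iff mult.commute)
  qed
  have "AE x in M. \<exists>K>0. \<forall>N. \<bar>(\<Sum>n<N. indicator (E n) x) - (\<Sum>n<N. prob (E n))\<bar>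
            \<le> K * koksma_error \<epsilon> (\<Sum>n<N. prob (E n))"
    by (rule quasi_independent_event_count[OF E_sets \<gamma> C corr assms(8)])
  then show ?thesis
  proof (rule AE_mp, intro AE_I2 impI)
    fix x assume x: "x \<in> space M"
      and bd: "\<exists>K>0. \<forall>N. \<bar>(\<Sum>n<N. indicator (E n) x) - (\<Sum>n<N. prob (E n))\<bar>
            \<le> K * koksma_error \<epsilon> (\<Sum>n<N. prob (E n))"
    have "measure_sum B M \<psi> x0 N = (\<Sum>n<N. prob (E n))" for N
      by (simp add: measure_sum_def E_prob sum.atLeast1_atMost_eq)
    moreover have "real (hit_count B T \<psi> x0 x N) = (\<Sum>n<N. indicator (E n) x)" for N
      unfolding hit_count_eq_sum E_def using x
      by (simp add: sum.atLeast1_atMost_eq indicator_def)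
    ultimately show "\<exists>K>0. \<forall>N\<ge>1.
           \<bar>real (hit_count B T \<psi> x0 x N) - measure_sum B M \<psi> x0 N\<bar>
             \<le> K * (measure_sum B M \<psi> x0 N powr (1/2)
                    * ln (measure_sum B M \<psi> x0 N + 2) powr (3/2 + \<epsilon>))"
      using bd unfolding koksma_error_def by auto
  qed
qed

end
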